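(* Let $\Bbbk$ be a field, let $n = 2k+1$ with $k \ge 3$ and $k \equiv 0$ or $3 \pmod 4$, and let $R = \Bbbk[x_1,\dots,x_n]$. Define the following sets of squarefree monomials: - $G_1 = \{x_{2i}x_{2j} \mid 1 \le i < j \le k\}$; - $\mathrm{NF} = \{x_i x_j \mid 1 \le i,j\le n,\ i \text{ odd},\ j \text{ even},\ i+1 < j\}$; - $G_2 = \{x_i x_j x_{2k+1} \mid 1 \le i < j \le 2k,\ x_i x_j \notin G_1 \cup \mathrm{NF}\}$; - $G_3 = \{x_i x_j x_l \mid 1 \le i < j < l \le 2k,\ i,j,l \text{ odd}\}$; - $G_4$: any set of exactly $$\frac12\cdot\frac{k(k+1)(4k-1)}{6} - \frac{k(k-1)(k-2)+6k^2}{6}$$ squarefree monomials of degree 3 in $R$, none belonging to $G_2 \cup G_3$ and none divisible by a monomial of $G_1 \cup \mathrm{NF}$. Then the ideal $I = \langle G_1 \cup G_2 \cup G_3 \cup G_4\rangle$ is an $f$-ideal.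
   Context: Let $I \subseteq \Bbbk[x_1,\dots,x_n]$ be a squarefree monomial ideal whose minimal monomial generators all have degree at least 2. Identify a subset $F \subseteq \{x_1,\dots,x_n\}$ with the squarefree monomial $x_F = \prod_{x_i \in F} x_i$. The Stanley-Reisner complex $\Delta_I$ is the simplicial complex whose faces are the sets $F$ with $x_F \notin I$. The facet complex $\Delta(I)$ is the simplicial complex whose facets are the sets $F$ such that $x_F$ is a minimal generator of $I$; that is, its faces are the sets $F$ such that $x_F$ divides some minimal generator of $I$. The $f$-vector of a simplicial complex of dimension $e$ is $(f_{-1},f_0,\dots,f_e)$, where $f_i$ is the number of faces with $i+1$ elements ($f_{-1}=1$ for a nonempty complex). The ideal $I$ is called an $f$-ideal if $\Delta_I$ and $\Delta(I)$ have the same $f$-vector. *)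

theory Defs
  imports Complex_Main "HOL-Library.Poly_Mapping" "HOL-Algebra.Ideal"
begin

section \<open>Polynomial rings\<close>

text \<open>A polynomial is a finitely supported map from exponent vectors to coefficients.  The type
  has one variable for every natural number; the ring in the variables with indices
  \<open>1, \<dots>, n\<close> is the carrier of \<open>poly_ring n\<close>, and ideals are ideals of that ring.\<close>

type_synonym 'a mpoly = "(nat \<Rightarrow>\<^sub>0 nat) \<Rightarrow>\<^sub>0 'a"

definition poly_ring :: "nat \<Rightarrow> 'a::field mpoly ring" where
  "poly_ring n =
     \<lparr>carrier = {p. \<forall>a \<in> Poly_Mapping.keys p. Poly_Mapping.keys a \<subseteq> {1..n}},
      mult = (*), one = 1, zero = 0, add = (+)\<rparr>"

lemma poly_ring_simps [simp]:
  "p \<in> carrier (poly_ring n) \<longleftrightarrow>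
     (\<forall>a \<in> Poly_Mapping.keys p. Poly_Mapping.keys a \<subseteq> {1..n})"
  "p \<otimes>\<^bsub>poly_ring n\<^esub> q = p * q" "\<one>\<^bsub>poly_ring n\<^esub> = 1"
  "\<zero>\<^bsub>poly_ring n\<^esub> = 0" "p \<oplus>\<^bsub>poly_ring n\<^esub> q = p + q"
  by (simp_all add: poly_ring_def)

lemma poly_ring_cring: "cring (poly_ring n :: 'a::field mpoly ring)"
proof (rule cringI)
  have mult_closed: "p * q \<in> carrier (poly_ring n)"
    if p: "p \<in> carrier (poly_ring n)" and q: "q \<in> carrier (poly_ring n)" for p q :: "'a mpoly"
  proof -
    have "Poly_Mapping.keys a \<subseteq> {1..n}" if a: "a \<in> Poly_Mapping.keys (p * q)" for a
    proof -
      obtain b c where "a = b + c" "b \<in> Poly_Mapping.keys p" "c \<in> Poly_Mapping.keys q"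
        using a keys_mult[of p q] by blast
      moreover have "Poly_Mapping.keys b \<subseteq> {1..n}" "Poly_Mapping.keys c \<subseteq> {1..n}"
        using calculation p q unfolding poly_ring_simps by blast+
      ultimately show ?thesis
        using Poly_Mapping.keys_add[of b c] by (meson Un_least order_trans)
    qed
    then show ?thesis unfolding poly_ring_simps by blast
  qed
  show "abelian_group (poly_ring n :: 'a mpoly ring)"
  proof (rule abelian_groupI)
    fix p q :: "'a mpoly"
    assume "p \<in> carrier (poly_ring n)" "q \<in> carrier (poly_ring n)"
    then show "p \<oplus>\<^bsub>poly_ring n\<^esub> q \<in> carrier (poly_ring n)"
      unfolding poly_ring_simps using Poly_Mapping.keys_add[of p q] by blast
  next
    fix p :: "'a mpoly"
    assume "p \<in> carrier (poly_ring n)"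
    then show "\<exists>q\<in>carrier (poly_ring n). q \<oplus>\<^bsub>poly_ring n\<^esub> p = \<zero>\<^bsub>poly_ring n\<^esub>"
      by (intro bexI[of _ "- p"]) (auto simp: in_keys_iff)
  qed (auto simp: algebra_simps)
  show "Group.comm_monoid (poly_ring n :: 'a mpoly ring)"
  proof (rule comm_monoidI)
    fix p q :: "'a mpoly"
    assume "p \<in> carrier (poly_ring n)" "q \<in> carrier (poly_ring n)"
    then show "p \<otimes>\<^bsub>poly_ring n\<^esub> q \<in> carrier (poly_ring n)"
      unfolding poly_ring_simps(2) by (rule mult_closed)
  qed (auto simp: algebra_simps)
qed (simp add: algebra_simps)

definition var :: "nat \<Rightarrow> 'a::field mpoly" where
  "var i = Poly_Mapping.single (Poly_Mapping.single i 1) 1"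

definition x_monom :: "nat set \<Rightarrow> 'a::field mpoly" where
  "x_monom F = (\<Prod>i\<in>F. var i)"

definition monom_of :: "(nat \<Rightarrow>\<^sub>0 nat) \<Rightarrow> 'a::field mpoly" where
  "monom_of a = Poly_Mapping.single a 1"

definition exp_degree :: "(nat \<Rightarrow>\<^sub>0 nat) \<Rightarrow> nat" where
  "exp_degree a = (\<Sum>i\<in>Poly_Mapping.keys a. Poly_Mapping.lookup a i)"

definition monomials :: "nat \<Rightarrow> 'a::field mpoly set" where
  "monomials n = {monom_of a |a. Poly_Mapping.keys a \<subseteq> {1..n}}"

definition sqfree_monomials :: "nat \<Rightarrow> 'a::field mpoly set" where
  "sqfree_monomials n = {x_monom F |F. F \<subseteq> {1..n}}"

definition sqfree_monomials_deg :: "nat \<Rightarrow> nat \<Rightarrow> 'a::field mpoly set" where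
  "sqfree_monomials_deg n d = {x_monom F |F. F \<subseteq> {1..n} \<and> card F = d}"

section \<open>Squarefree monomial ideals and f-ideals\<close>

definition sqfree_monomial_ideal :: "nat \<Rightarrow> 'a::field mpoly set \<Rightarrow> bool" where
  "sqfree_monomial_ideal n I \<longleftrightarrow> (\<exists>S \<subseteq> sqfree_monomials n. I = Idl\<^bsub>poly_ring n\<^esub> S)"

definition min_monomial_gen_set :: "nat \<Rightarrow> 'a::field mpoly set \<Rightarrow> 'a mpoly set \<Rightarrow> bool" where
  "min_monomial_gen_set n I G \<longleftrightarrow>
     G \<subseteq> monomials n \<and> Idl\<^bsub>poly_ring n\<^esub> G = I \<and> (\<forall>H. H \<subset> G \<longrightarrow> Idl\<^bsub>poly_ring n\<^esub> H \<noteq> I)"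

text \<open>A monomial ideal has exactly one minimal monomial generating set, so the union below has
  a single member.\<close>

definition min_gens :: "nat \<Rightarrow> 'a::field mpoly set \<Rightarrow> 'a mpoly set" where
  "min_gens n I = \<Union>{G. min_monomial_gen_set n I G}"

text \<open>A face is the set of the indices of its variables.\<close>

definition stanley_reisner_complex :: "nat \<Rightarrow> 'a::field mpoly set \<Rightarrow> nat set set" where
  "stanley_reisner_complex n I = {F. F \<subseteq> {1..n} \<and> x_monom F \<notin> I}"

definition facet_complex :: "nat \<Rightarrow> 'a::field mpoly set \<Rightarrow> nat set set" where
  "facet_complex n I = {F. F \<subseteq> {1..n} \<and> (\<exists>g \<in> min_gens n I. x_monom F dvd g)}"

text \<open>The list \<open>[f\<^sub>-\<^sub>1, f\<^sub>0, \<dots>, f\<^sub>e]\<close>, where \<open>e + 1\<close> is the largest size of a face; it is empty for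
  the complex without faces.\<close>

definition f_vector :: "nat set set \<Rightarrow> nat list" where
  "f_vector D =
     (if D = {} then []
      else map (\<lambda>i. card {F \<in> D. card F = i}) [0..<Suc (Max (card ` D))])"

definition f_ideal :: "nat \<Rightarrow> 'a::field mpoly set \<Rightarrow> bool" where
  "f_ideal n I \<longleftrightarrow>
     sqfree_monomial_ideal n I \<and>
     (\<forall>a. monom_of a \<in> min_gens n I \<longrightarrow> exp_degree a \<ge> 2) \<and>
     f_vector (stanley_reisner_complex n I) = f_vector (facet_complex n I)"

section \<open>The generators\<close>

definition G1 :: "nat \<Rightarrow> 'a::field mpoly set" where
  "G1 k = {var (2 * i) * var (2 * j) |i j. 1 \<le> i \<and> i < j \<and> j \<le> k}"

definition NF :: "nat \<Rightarrow> 'a::field mpoly set" where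
  "NF n = {var i * var j |i j.
     1 \<le> i \<and> i \<le> n \<and> 1 \<le> j \<and> j \<le> n \<and> odd i \<and> even j \<and> i + 1 < j}"

definition G2 :: "nat \<Rightarrow> 'a::field mpoly set" where
  "G2 k = {var i * var j * var (2 * k + 1) |i j.
     1 \<le> i \<and> i < j \<and> j \<le> 2 * k \<and> var i * var j \<notin> (G1 k \<union> NF (2 * k + 1) :: 'a mpoly set)}"

definition G3 :: "nat \<Rightarrow> 'a::field mpoly set" where
  "G3 k = {var i * var j * var l |i j l.
     1 \<le> i \<and> i < j \<and> j < l \<and> l \<le> 2 * k \<and> odd i \<and> odd j \<and> odd l}"

end

theory Submission
  imports Defs
begin

text \<open>A squarefree monomial lies in \<open>I\<close> exactly when its index set contains the index set of a
  generator, and the generators form an antichain, so they are the minimal ones.  Both complexes are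
  therefore read off from set systems on \<open>{1..n}\<close>: the pairs \<open>Q\<close> (the index sets of \<open>G1\<close>) and the
  triples \<open>T\<close> (those of \<open>G2\<close>, \<open>G3\<close>, \<open>G4\<close>), no triple containing a pair of \<open>Q\<close>.  The f-vectors
  are compared one face size at a time (\<open>f_ideal_of_pairs_and_triples\<close>).

  Up to size 1 both complexes are full.  In size 2 the Stanley-Reisner complex misses the pairs in
  \<open>Q\<close>, and the facet complex misses the pairs that lie inside no generator.  The latter are exactly the
  pairs of \<open>NF\<close>: no generator contains one, and any other pair either belongs to \<open>Q\<close> or is completed
  by \<open>G2\<close> to a triple through the last index \<open>2 * k + 1\<close>.  Both kinds number \<open>k choose 2\<close>.

  In size 3 the faces of the facet complex are \<open>T\<close>, and those of the Stanley-Reisner complex are the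
  triples with at most one even index that are not in \<open>T\<close>.  So \<open>T\<close> has to be half of the
  \<open>k * (k + 1) * (4 * k - 1) / 6\<close> triples with at most one even index.  As \<open>G2\<close> has \<open>k^2\<close> elements
  and \<open>G3\<close> has \<open>k choose 3\<close>, the prescribed size of \<open>G4\<close> is what is missing to that half.

  In size 4 neither complex has a face: four indices contain two even ones (\<open>G1\<close>), or three odd ones
  below the last index (\<open>G3\<close>), or two such odd ones together with the last index (\<open>G2\<close>).\<close>

section \<open>Monomial ideals\<close>

lemma keys_monom_of [simp]: "Poly_Mapping.keys (monom_of a :: 'a::field mpoly) = {a}"
  by (simp add: monom_of_def)

lemma inj_monom_of: "inj (monom_of :: _ \<Rightarrow> 'a::field mpoly)"
  by (rule injI) (metis keys_monom_of singleton_inject)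

lemma monom_of_mult: "monom_of a * monom_of b = (monom_of (a + b) :: 'a::field mpoly)"
  by (simp add: monom_of_def mult_single)

lemma monom_of_dvd_iff:
  "(monom_of a :: 'a::field mpoly) dvd monom_of b \<longleftrightarrow> (\<exists>c. b = a + c)"
proof
  assume "(monom_of a :: 'a mpoly) dvd monom_of b"
  then obtain q :: "'a mpoly" where "monom_of b = monom_of a * q" by (auto elim: dvdE)
  then have "b \<in> Poly_Mapping.keys (monom_of a * q)" by (metis keys_monom_of singletonI)
  then show "\<exists>c. b = a + c" using keys_mult[of "monom_of a" q] by auto
next
  assume "\<exists>c. b = a + c"
  then show "(monom_of a :: 'a mpoly) dvd monom_of b"
    by (metis dvd_triv_left monom_of_mult)
qed

text \<open>Bounds the ideal generated by a set of monomials from above: all exponents of its elements are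
  multiples of generating exponents.\<close>

lemma ideal_multiples:
  fixes B :: "(nat \<Rightarrow>\<^sub>0 nat) set"
  shows "ideal {p \<in> carrier (poly_ring n :: 'a::field mpoly ring).
                 \<forall>a \<in> Poly_Mapping.keys p. \<exists>b\<in>B. \<exists>c. a = b + c} (poly_ring n)"
    (is "ideal ?J ?R")
proof -
  interpret R: cring ?R by (rule poly_ring_cring)
  have mult_closed: "q * p \<in> ?J" if p: "p \<in> ?J" and q: "q \<in> carrier ?R" for p q
  proof -
    have "\<exists>b\<in>B. \<exists>c. a = b + c" if a: "a \<in> Poly_Mapping.keys (q * p)" for a
    proof -
      obtain d e where "a = d + e" "e \<in> Poly_Mapping.keys p"
        using a keys_mult[of q p] by blast
      moreover then obtain b c where "b \<in> B" "e = b + c" using p by blast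
      ultimately have "a = b + (d + c)" by (simp add: algebra_simps)
      then show ?thesis using \<open>b \<in> B\<close> by blast
    qed
    moreover have "q * p \<in> carrier ?R"
      using R.m_closed[of q p] p q unfolding poly_ring_simps(2) by blast
    ultimately show ?thesis by blast
  qed
  show ?thesis
  proof (rule idealI)
    show "subgroup ?J (add_monoid ?R)"
    proof (rule subgroup.intro)
      fix p q assume "p \<in> ?J" "q \<in> ?J"
      then have "p + q \<in> ?J"
        using Poly_Mapping.keys_add[of p q] R.a_closed[of p q] unfolding poly_ring_simps(5) by blast
      then show "p \<otimes>\<^bsub>add_monoid ?R\<^esub> q \<in> ?J" by simp
    next
      fix p assume p: "p \<in> ?J"
      then have m: "- p \<in> ?J" by (auto simp: in_keys_iff)
      have "\<ominus>\<^bsub>?R\<^esub> p = - p"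
        using R.minus_equality[of "- p" p] p m by auto
      then show "inv\<^bsub>add_monoid ?R\<^esub> p \<in> ?J" using m by (simp add: a_inv_def)
    qed auto
  next
    fix p q assume "p \<in> ?J" "q \<in> carrier ?R"
    then show "q \<otimes>\<^bsub>?R\<^esub> p \<in> ?J" "p \<otimes>\<^bsub>?R\<^esub> q \<in> ?J"
      using mult_closed[of p q] by (simp_all only: poly_ring_simps mult.commute[of p q])
  qed (rule R.ring_axioms)
qed

text \<open>A polynomial of the monomial ideal has only exponents divisible by a generator; for a
  single monomial this necessary condition is also sufficient.\<close>

lemma monom_of_in_Idl_iff:
  assumes B: "\<forall>b\<in>B. Poly_Mapping.keys b \<subseteq> {1..n}"
    and a: "Poly_Mapping.keys a \<subseteq> {1..n}"
  shows "(monom_of a :: 'a::field mpoly) \<in> Idl\<^bsub>poly_ring n\<^esub> (monom_of ` B)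
           \<longleftrightarrow> (\<exists>b\<in>B. \<exists>c. a = b + c)"
proof -
  interpret R: cring "poly_ring n :: 'a mpoly ring" by (rule poly_ring_cring)
  let ?J = "{p \<in> carrier (poly_ring n :: 'a mpoly ring).
                 \<forall>a \<in> Poly_Mapping.keys p. \<exists>b\<in>B. \<exists>c. a = b + c}"
  have sub: "monom_of ` B \<subseteq> carrier (poly_ring n :: 'a mpoly ring)"
    using B by (fastforce simp del: One_nat_def)
  moreover have "\<exists>b'\<in>B. \<exists>c. b = b' + c" if "b \<in> B" for b
    using that by (metis add.right_neutral)
  ultimately have "monom_of ` B \<subseteq> ?J" by (auto simp del: poly_ring_simps(1))
  then have "Idl\<^bsub>poly_ring n\<^esub> (monom_of ` B) \<subseteq> ?J"
    by (rule R.genideal_minimal[OF ideal_multiples])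
  moreover have "monom_of a \<in> Idl\<^bsub>poly_ring n\<^esub> (monom_of ` B :: 'a mpoly set)"
    if b: "b \<in> B" and ab: "a = b + c" for b c
  proof -
    have "Poly_Mapping.keys c \<subseteq> Poly_Mapping.keys a"
      by (auto simp: ab in_keys_iff lookup_add)
    then have "monom_of c \<in> carrier (poly_ring n :: 'a mpoly ring)" using a by auto
    moreover have "monom_of b \<in> Idl\<^bsub>poly_ring n\<^esub> (monom_of ` B :: 'a mpoly set)"
      using R.genideal_self[OF sub] b by blast
    ultimately have "monom_of b \<otimes>\<^bsub>poly_ring n\<^esub> monom_of c
        \<in> Idl\<^bsub>poly_ring n\<^esub> (monom_of ` B :: 'a mpoly set)"
      using ideal.I_r_closed[OF R.genideal_ideal[OF sub]] by blast
    then show ?thesis by (simp add: ab monom_of_mult)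
  qed
  ultimately show ?thesis by auto
qed

lemma exponent_antisym:
  fixes a b c d :: "nat \<Rightarrow>\<^sub>0 nat"
  assumes "a = b + c" "b = a + d"
  shows "a = b"
proof -
  have "a + 0 = a + (d + c)" using assms by (simp add: add.assoc)
  then have "d + c = 0" by (metis add_left_imp_eq)
  then have "c = 0"
    by (intro poly_mapping_eqI) (metis add_is_0 lookup_add lookup_zero)
  then show ?thesis using assms by simp
qed

text \<open>If another set of monomials generates the same ideal, every monomial of the antichain is a
  multiple of a monomial of that set, which in turn is a multiple of one of the antichain; so the three
  coincide, and the other set contains the antichain.  Minimality then forces equality.\<close>

lemma min_gens_antichain:
  assumes A: "\<forall>a\<in>A. Poly_Mapping.keys a \<subseteq> {1..n}"
    and anti: "\<And>a b c. a \<in> A \<Longrightarrow> b \<in> A \<Longrightarrow> a = b + c \<Longrightarrow> a = b"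
  shows "min_gens n (Idl\<^bsub>poly_ring n\<^esub> (monom_of ` A)) = (monom_of ` A :: 'a::field mpoly set)"
proof -
  interpret R: cring "poly_ring n :: 'a mpoly ring" by (rule poly_ring_cring)
  let ?I = "Idl\<^bsub>poly_ring n\<^esub> (monom_of ` A :: 'a mpoly set)"
  have self: "monom_of b \<in> Idl\<^bsub>poly_ring n\<^esub> (monom_of ` B :: 'a mpoly set)"
    if "b \<in> B" "\<forall>b\<in>B. Poly_Mapping.keys b \<subseteq> {1..n}" for b B
  proof -
    have "\<exists>b'\<in>B. \<exists>c. b = b' + c" using that(1) by (metis add.right_neutral)
    then show ?thesis
      by (rule iffD2[OF monom_of_in_Idl_iff[OF that(2) bspec[OF that(2,1)]]])
  qed
  have min: "min_monomial_gen_set n ?I (monom_of ` A)"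
    unfolding min_monomial_gen_set_def
  proof (intro conjI allI impI)
    show "monom_of ` A \<subseteq> (monomials n :: 'a mpoly set)" using A by (auto simp: monomials_def)
  next
    fix H :: "'a mpoly set"
    assume H: "H \<subset> monom_of ` A"
    then obtain B where B: "H = monom_of ` B" "B \<subseteq> A" by (meson psubset_imp_subset subset_imageE)
    then obtain a where a: "a \<in> A" "a \<notin> B" using H by blast
    have "monom_of a \<notin> Idl\<^bsub>poly_ring n\<^esub> H"
    proof
      assume *: "monom_of a \<in> Idl\<^bsub>poly_ring n\<^esub> H"
      have Bn: "\<forall>b\<in>B. Poly_Mapping.keys b \<subseteq> {1..n}" using A B(2) by blast
      have "\<exists>b\<in>B. \<exists>c. a = b + c"
        by (rule iffD1[OF monom_of_in_Idl_iff[OF Bn bspec[OF A a(1)]] *[unfolded B(1)]])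
      then obtain b c where b: "b \<in> B" "a = b + c" by blast
      have "a = b" by (rule anti[OF a(1) subsetD[OF B(2) b(1)] b(2)])
      then show False using a(2) b(1) by simp
    qed
    moreover have "(monom_of a :: 'a mpoly) \<in> ?I" by (rule self[OF a(1) A])
    ultimately show "Idl\<^bsub>poly_ring n\<^esub> H \<noteq> ?I" by metis
  qed simp
  have unique: "G = monom_of ` A" if G: "min_monomial_gen_set n ?I G" for G
  proof -
    have "G \<subseteq> range monom_of" and gen: "Idl\<^bsub>poly_ring n\<^esub> G = ?I"
      using G by (auto simp: min_monomial_gen_set_def monomials_def)
    then obtain B where B: "G = monom_of ` B" by blast
    have Bn: "\<forall>b\<in>B. Poly_Mapping.keys b \<subseteq> {1..n}"
    proof
      fix b assume b: "b \<in> B"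
      have "(monom_of b :: 'a mpoly) \<in> monomials n"
        using G b unfolding min_monomial_gen_set_def B by blast
      then obtain b' where "(monom_of b :: 'a mpoly) = monom_of b'" "Poly_Mapping.keys b' \<subseteq> {1..n}"
        unfolding monomials_def by blast
      then show "Poly_Mapping.keys b \<subseteq> {1..n}" using injD[OF inj_monom_of] by metis
    qed
    have "A \<subseteq> B"
    proof
      fix a assume a: "a \<in> A"
      then have "monom_of a \<in> Idl\<^bsub>poly_ring n\<^esub> (monom_of ` B :: 'a mpoly set)"
        using self[OF a A] unfolding gen[unfolded B] by simp
      then have "\<exists>b\<in>B. \<exists>c. a = b + c"
        by (rule iffD1[OF monom_of_in_Idl_iff[OF Bn bspec[OF A a]]])
      then obtain b c where b: "b \<in> B" "a = b + c" by blast
      have "(monom_of b :: 'a mpoly) \<in> ?I" using self[OF b(1) Bn] unfolding gen[unfolded B] by simp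
      then have "\<exists>a'\<in>A. \<exists>d. b = a' + d"
        by (rule iffD1[OF monom_of_in_Idl_iff[OF A bspec[OF Bn b(1)]]])
      then obtain a' d where a': "a' \<in> A" "b = a' + d" by blast
      have "a = a' + (d + c)" unfolding b(2) a'(2) by (rule add.assoc)
      then have "a = a'" by (rule anti[OF a a'(1)])
      then have "a = b" using exponent_antisym[OF b(2)] a'(2) by metis
      then show "a \<in> B" using b by simp
    qed
    then have "monom_of ` A \<subseteq> G" using B by blast
    then show ?thesis
      using G unfolding min_monomial_gen_set_def by blast
  qed
  show ?thesis unfolding min_gens_def using min unique by blast
qed

section \<open>Squarefree monomials as sets of indices\<close>

text \<open>The indicator of \<open>F\<close> as an exponent vector.\<close>

definition sq_exp :: "nat set \<Rightarrow> (nat \<Rightarrow>\<^sub>0 nat)" where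
  "sq_exp F = (\<Sum>i\<in>F. Poly_Mapping.single i 1)"

lemma lookup_sq_exp:
  "finite F \<Longrightarrow> Poly_Mapping.lookup (sq_exp F) i = (if i \<in> F then 1 else 0)"
  by (simp add: sq_exp_def lookup_sum lookup_single when_def)

lemma keys_sq_exp: "finite F \<Longrightarrow> Poly_Mapping.keys (sq_exp F) = F"
  by (auto simp: in_keys_iff lookup_sq_exp split: if_splits)

lemma exp_degree_sq_exp: "finite F \<Longrightarrow> exp_degree (sq_exp F) = card F"
  by (simp add: exp_degree_def keys_sq_exp lookup_sq_exp)

lemma x_monom_eq_monom_of: "x_monom F = (monom_of (sq_exp F) :: 'a::field mpoly)"
  by (induction F rule: infinite_finite_induct)
    (simp_all add: x_monom_def sq_exp_def monom_of_def var_def mult_single)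

lemma sq_exp_split_iff:
  assumes "finite F" "finite H"
  shows "(\<exists>c. sq_exp H = sq_exp F + c) \<longleftrightarrow> F \<subseteq> H"
proof
  assume "\<exists>c. sq_exp H = sq_exp F + c"
  then obtain c where c: "sq_exp H = sq_exp F + c" ..
  show "F \<subseteq> H"
  proof
    fix i assume "i \<in> F"
    then have "Poly_Mapping.lookup (sq_exp H) i \<noteq> 0"
      using assms by (simp add: c lookup_add lookup_sq_exp)
    then show "i \<in> H" using assms by (auto simp: lookup_sq_exp split: if_splits)
  qed
next
  assume "F \<subseteq> H"
  then have "sq_exp H = sq_exp F + sq_exp (H - F)"
    using assms by (auto simp: sq_exp_def sum.subset_diff add.commute)
  then show "\<exists>c. sq_exp H = sq_exp F + c" ..
qed

lemma x_monom_dvd_iff: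
  "finite F \<Longrightarrow> finite H \<Longrightarrow> (x_monom F :: 'a::field mpoly) dvd x_monom H \<longleftrightarrow> F \<subseteq> H"
  by (simp add: x_monom_eq_monom_of monom_of_dvd_iff sq_exp_split_iff)

lemma x_monom_inject:
  "finite F \<Longrightarrow> finite H \<Longrightarrow> (x_monom F :: 'a::field mpoly) = x_monom H \<longleftrightarrow> F = H"
  by (metis dvd_refl subset_antisym x_monom_dvd_iff)

lemma x_monom_in_image_iff:
  assumes "finite F" "\<forall>E\<in>\<G>. finite E"
  shows "(x_monom F :: 'a::field mpoly) \<in> x_monom ` \<G> \<longleftrightarrow> F \<in> \<G>"
proof
  assume "(x_monom F :: 'a mpoly) \<in> x_monom ` \<G>"
  then obtain E where "E \<in> \<G>" "(x_monom F :: 'a mpoly) = x_monom E" by (rule imageE)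
  then show "F \<in> \<G>" using assms x_monom_inject[of F E, where 'a = 'a] by auto
qed (rule imageI)

lemma stanley_reisner_complex_sets:
  assumes "\<And>E. E \<in> \<G> \<Longrightarrow> E \<subseteq> {1..n}"
  shows "stanley_reisner_complex n (Idl\<^bsub>poly_ring n\<^esub> (x_monom ` \<G> :: 'a::field mpoly set))
           = {F. F \<subseteq> {1..n} \<and> (\<forall>E\<in>\<G>. \<not> E \<subseteq> F)}"
proof -
  have img: "x_monom ` \<G> = (monom_of ` sq_exp ` \<G> :: 'a mpoly set)"
    by (simp add: image_image x_monom_eq_monom_of)
  have fin: "finite F" if "F \<subseteq> {1..n}" for F
    using that finite_subset by blast
  have "x_monom F \<in> Idl\<^bsub>poly_ring n\<^esub> (x_monom ` \<G> :: 'a mpoly set) \<longleftrightarrow> (\<exists>E\<in>\<G>. E \<subseteq> F)"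
    if F: "F \<subseteq> {1..n}" for F
  proof -
    have "\<forall>b\<in>sq_exp ` \<G>. Poly_Mapping.keys b \<subseteq> {1..n}"
      using assms fin by (simp add: keys_sq_exp del: One_nat_def)
    moreover have "Poly_Mapping.keys (sq_exp F) \<subseteq> {1..n}" using F fin keys_sq_exp by metis
    ultimately have "x_monom F \<in> Idl\<^bsub>poly_ring n\<^esub> (x_monom ` \<G> :: 'a mpoly set)
        \<longleftrightarrow> (\<exists>b\<in>sq_exp ` \<G>. \<exists>c. sq_exp F = b + c)"
      unfolding img x_monom_eq_monom_of by (rule monom_of_in_Idl_iff)
    also have "\<dots> \<longleftrightarrow> (\<exists>E\<in>\<G>. E \<subseteq> F)"
      using assms F fin by (simp add: sq_exp_split_iff)
    finally show ?thesis .
  qed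
  then show ?thesis unfolding stanley_reisner_complex_def by blast
qed

lemma min_gens_sets:
  assumes sub: "\<And>E. E \<in> \<G> \<Longrightarrow> E \<subseteq> {1..n}"
    and anti: "\<And>E F. E \<in> \<G> \<Longrightarrow> F \<in> \<G> \<Longrightarrow> E \<subseteq> F \<Longrightarrow> E = F"
  shows "min_gens n (Idl\<^bsub>poly_ring n\<^esub> (x_monom ` \<G>)) = (x_monom ` \<G> :: 'a::field mpoly set)"
proof -
  have img: "x_monom ` \<G> = (monom_of ` sq_exp ` \<G> :: 'a mpoly set)"
    by (simp add: image_image x_monom_eq_monom_of)
  have fin: "finite F" if "F \<in> \<G>" for F
    using that sub finite_subset by blast
  show ?thesis
    unfolding img
  proof (rule min_gens_antichain)
    show "\<forall>a\<in>sq_exp ` \<G>. Poly_Mapping.keys a \<subseteq> {1..n}"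
      using sub fin by (simp add: keys_sq_exp del: One_nat_def)
  next
    fix a b c assume "a \<in> sq_exp ` \<G>" "b \<in> sq_exp ` \<G>" "a = b + c"
    then show "a = b" using anti fin by (metis imageE sq_exp_split_iff)
  qed
qed

lemma facet_complex_sets:
  assumes sub: "\<And>E. E \<in> \<G> \<Longrightarrow> E \<subseteq> {1..n}"
    and anti: "\<And>E F. E \<in> \<G> \<Longrightarrow> F \<in> \<G> \<Longrightarrow> E \<subseteq> F \<Longrightarrow> E = F"
  shows "facet_complex n (Idl\<^bsub>poly_ring n\<^esub> (x_monom ` \<G> :: 'a::field mpoly set))
           = {F. \<exists>E\<in>\<G>. F \<subseteq> E}"
proof -
  have fin: "finite F" if "F \<subseteq> {1..n}" for F
    using that finite_subset by blast
  have min: "min_gens n (Idl\<^bsub>poly_ring n\<^esub> (x_monom ` \<G> :: 'a mpoly set)) = x_monom ` \<G>"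
    using sub anti by (rule min_gens_sets)
  have dvd: "(x_monom F :: 'a mpoly) dvd x_monom E \<longleftrightarrow> F \<subseteq> E" if "F \<subseteq> {1..n}" "E \<in> \<G>" for E F
    using that sub fin by (simp add: x_monom_dvd_iff)
  have "(F \<subseteq> {1..n} \<and> (\<exists>g\<in>x_monom ` \<G>. (x_monom F :: 'a mpoly) dvd g)) \<longleftrightarrow> (\<exists>E\<in>\<G>. F \<subseteq> E)" for F
  proof (cases "F \<subseteq> {1..n}")
    case True
    then show ?thesis using dvd[OF True] by simp
  next
    case False
    then show ?thesis using sub by (meson order_trans)
  qed
  then show ?thesis unfolding facet_complex_def min by simp
qed

section \<open>f-vectors\<close>

text \<open>The length of the f-vector is determined by the counts, because a size occurs among the faces
  exactly when its count is nonzero.\<close>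

lemma f_vector_eqI:
  assumes fin: "finite D" "finite D'"
    and eq: "\<And>i. card {F \<in> D. card F = i} = card {F \<in> D'. card F = i}"
  shows "f_vector D = f_vector D'"
proof -
  have *: "i \<in> card ` D \<longleftrightarrow> card {F \<in> D. card F = i} \<noteq> 0" if "finite D" for i and D :: "nat set set"
    using that by (auto simp: card_eq_0_iff)
  have img: "card ` D = card ` D'"
    by (intro Set.set_eqI) (simp only: *[OF fin(1)] *[OF fin(2)] eq)
  then have "D = {} \<longleftrightarrow> D' = {}" by (metis image_is_empty)
  then show ?thesis by (simp add: f_vector_def eq img)
qed

text \<open>In size 2 the Stanley-Reisner complex misses the pairs in \<open>Q\<close> and the facet complex misses the
  pairs inside no generator, so \<open>pairs\<close> equates the counts.  In size 3 the first complex consists of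
  the triples that contain no pair of \<open>Q\<close> and are not in \<open>T\<close>, the second of \<open>T\<close>; hence the factor 2
  in \<open>triples\<close>.  By \<open>points\<close> both contain every set of size at most 1, and by \<open>quads\<close> none of size 4
  or more.\<close>

lemma f_ideal_of_pairs_and_triples:
  assumes n: "0 < n"
    and Q: "\<And>E. E \<in> Q \<Longrightarrow> E \<subseteq> {1..n} \<and> card E = 2"
    and T: "\<And>E. E \<in> T \<Longrightarrow> E \<subseteq> {1..n} \<and> card E = 3"
    and anti: "\<And>E F. E \<in> Q \<Longrightarrow> F \<in> T \<Longrightarrow> \<not> E \<subseteq> F"
    and points: "\<And>i. i \<in> {1..n} \<Longrightarrow> \<exists>E\<in>Q \<union> T. i \<in> E"
    and pairs: "card {P. P \<subseteq> {1..n} \<and> card P = 2 \<and> (\<forall>E\<in>Q \<union> T. \<not> P \<subseteq> E)} = card Q"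
    and triples: "card {S. S \<subseteq> {1..n} \<and> card S = 3 \<and> (\<forall>E\<in>Q. \<not> E \<subseteq> S)} = 2 * card T"
    and quads: "\<And>F. F \<subseteq> {1..n} \<Longrightarrow> card F = 4 \<Longrightarrow> \<exists>E\<in>Q \<union> T. E \<subseteq> F"
  shows "f_ideal n (Idl\<^bsub>poly_ring n\<^esub> (x_monom ` (Q \<union> T) :: 'a::field mpoly set))"
proof -
  let ?I = "Idl\<^bsub>poly_ring n\<^esub> (x_monom ` (Q \<union> T) :: 'a mpoly set)"
  have sub: "E \<subseteq> {1..n}" if "E \<in> Q \<union> T" for E using that Q T by blast
  have fin: "finite E" if "E \<subseteq> {1..n}" for E using that finite_subset by blast
  have finfam: "finite \<F>" if "\<And>E. E \<in> \<F> \<Longrightarrow> E \<subseteq> {1..n}" for \<F>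
    by (rule finite_subset[of _ "Pow {1..n}"]) (use that in auto)
  have finQ: "finite Q" by (rule finfam) (use Q in blast)
  have finT: "finite T" by (rule finfam) (use T in blast)
  have card23: "card E = 2 \<or> card E = 3" if "E \<in> Q \<union> T" for E using that Q T by blast
  have antichain: "E = F" if "E \<in> Q \<union> T" "F \<in> Q \<union> T" "E \<subseteq> F" for E F
  proof -
    have "card E \<le> card F" using that sub fin by (meson card_mono)
    then have "card E = card F" using that Q T anti by fastforce
    then show ?thesis using that sub fin by (meson card_subset_eq)
  qed
  have gens: "min_gens n ?I = x_monom ` (Q \<union> T)"
    using sub antichain by (rule min_gens_sets)
  define SR where "SR = {F. F \<subseteq> {1..n} \<and> (\<forall>E\<in>Q \<union> T. \<not> E \<subseteq> F)}"
  define FC where "FC = {F. \<exists>E\<in>Q \<union> T. F \<subseteq> E}"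
  have SR: "stanley_reisner_complex n ?I = SR"
    unfolding SR_def using sub by (rule stanley_reisner_complex_sets)
  have FC: "facet_complex n ?I = FC"
    unfolding FC_def using sub antichain by (rule facet_complex_sets)
  have subSR: "F \<subseteq> {1..n}" if "F \<in> SR" for F using that by (simp add: SR_def)
  have subFC: "F \<subseteq> {1..n}" if "F \<in> FC" for F using that sub unfolding FC_def by blast
  have "card {F \<in> SR. card F = i} = card {F \<in> FC. card F = i}" for i
  proof -
    have small: "F \<in> SR" if "F \<subseteq> {1..n}" "card F \<le> 1" for F
    proof -
      have "\<not> E \<subseteq> F" if "E \<in> Q \<union> T" for E
        using card_mono[OF fin[OF \<open>F \<subseteq> {1..n}\<close>], of E] card23[OF that] \<open>card F \<le> 1\<close> by auto
      then show ?thesis using that by (simp add: SR_def)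
    qed
    have small': "F \<in> FC" if F: "F \<subseteq> {1..n}" "card F \<le> 1" for F
    proof (cases "card F = 0")
      case True
      then have "F = {}" using fin[OF F(1)] by simp
      moreover obtain E where "E \<in> Q \<union> T" using points[of 1] n by auto
      ultimately show ?thesis by (auto simp: FC_def)
    next
      case False
      then obtain i where "F = {i}" using F by (metis One_nat_def card_1_singletonE le_neq_implies_less less_one)
      then show ?thesis using points[of i] F by (auto simp: FC_def)
    qed
    consider "i \<le> 1" | "i = 2" | "i = 3" | "i \<ge> 4" by linarith
    then show ?thesis
    proof cases
      case 1
      have "{F \<in> SR. card F = i} = {F \<in> FC. card F = i}"
        using small small' subSR subFC 1 by blast
      then show ?thesis by simp
    next
      case 2
      let ?P = "{P. P \<subseteq> {1..n} \<and> card P = 2}"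
      have "E \<in> Q" if "E \<in> Q \<union> T" "E \<subseteq> P" "P \<subseteq> {1..n}" "card P = 2" for E P
        using card_mono[OF fin[OF that(3)] that(2)] that(1,4) T by fastforce
      moreover have "E = P" if "E \<in> Q" "E \<subseteq> P" "P \<subseteq> {1..n}" "card P = 2" for E P
        using that Q fin by (metis card_subset_eq)
      ultimately have "{F \<in> SR. card F = i} = ?P - Q"
        unfolding SR_def 2 using Q by blast
      moreover have "{F \<in> FC. card F = i}
          = ?P - {P. P \<subseteq> {1..n} \<and> card P = 2 \<and> (\<forall>E\<in>Q \<union> T. \<not> P \<subseteq> E)}"
        unfolding FC_def 2 using sub by blast
      moreover have "card (?P - Q) = card ?P - card Q"
        by (rule card_Diff_subset[OF finQ]) (use Q in blast)
      moreover have "card (?P - {P. P \<subseteq> {1..n} \<and> card P = 2 \<and> (\<forall>E\<in>Q \<union> T. \<not> P \<subseteq> E)})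
          = card ?P - card Q"
        unfolding pairs[symmetric] by (rule card_Diff_subset[OF finfam]) blast+
      ultimately show ?thesis by simp
    next
      case 3
      let ?S = "{S. S \<subseteq> {1..n} \<and> card S = 3 \<and> (\<forall>E\<in>Q. \<not> E \<subseteq> S)}"
      have eqT: "E = S" if "E \<in> T" "E \<subseteq> S" "S \<subseteq> {1..n}" "card S = 3" for E S
        using that T fin by (metis card_subset_eq)
      have "{F \<in> SR. card F = i} = ?S - T"
        unfolding SR_def 3 using eqT T by blast
      moreover have "card (?S - T) = card ?S - card T"
        by (rule card_Diff_subset[OF finT]) (use T anti in blast)
      moreover have "{F \<in> FC. card F = i} = T"
      proof -
        have "F \<in> T" if "E \<in> Q \<union> T" "F \<subseteq> E" "card F = 3" for E F
        proof -
          have "card F \<le> card E" using that sub fin by (meson card_mono)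
          then have "E \<in> T" using that Q by fastforce
          then show ?thesis using that T fin by (metis card_subset_eq)
        qed
        then show ?thesis unfolding FC_def 3 using T by blast
      qed
      ultimately show ?thesis using triples by simp
    next
      case 4
      have "F \<notin> SR" if F: "card F = i" for F
      proof
        assume "F \<in> SR"
        obtain H where H: "H \<subseteq> F" "card H = 4"
          using obtain_subset_with_card_n[of 4 F] F 4 by metis
        then obtain E where "E \<in> Q \<union> T" "E \<subseteq> H" using quads[of H] subSR[OF \<open>F \<in> SR\<close>] by blast
        then show False using \<open>F \<in> SR\<close> H unfolding SR_def by blast
      qed
      moreover have "F \<notin> FC" if F: "card F = i" for F
      proof
        assume "F \<in> FC"
        then obtain E where E: "E \<in> Q \<union> T" "F \<subseteq> E" by (auto simp: FC_def)
        then have "card F \<le> card E" using sub fin by (meson card_mono)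
        then show False using card23[OF E(1)] F 4 by auto
      qed
      ultimately have "{F \<in> SR. card F = i} = {}" "{F \<in> FC. card F = i} = {}" by blast+
      then show ?thesis by (simp only:)
    qed
  qed
  then have "f_vector SR = f_vector FC"
    using finfam subSR subFC by (intro f_vector_eqI) blast+
  moreover have "sqfree_monomial_ideal n ?I"
    unfolding sqfree_monomial_ideal_def
  proof (rule exI[of _ "x_monom ` (Q \<union> T)"], rule conjI)
    show "x_monom ` (Q \<union> T) \<subseteq> (sqfree_monomials n :: 'a mpoly set)"
    proof (rule image_subsetI)
      fix E assume "E \<in> Q \<union> T"
      then show "x_monom E \<in> (sqfree_monomials n :: 'a mpoly set)"
        using sub[of E] unfolding sqfree_monomials_def by blast
    qed
  qed (rule refl)
  moreover have "exp_degree a \<ge> 2" if a: "monom_of a \<in> min_gens n ?I" for a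
  proof -
    obtain E where E: "E \<in> Q \<union> T" "(monom_of a :: 'a mpoly) = x_monom E"
      using a unfolding gens by blast
    then have "a = sq_exp E"
      unfolding x_monom_eq_monom_of using inj_monom_of by (metis injD)
    then have "exp_degree a = card E" using exp_degree_sq_exp[OF fin[OF sub[OF E(1)]]] by simp
    then show ?thesis using card23[OF E(1)] by auto
  qed
  ultimately show ?thesis unfolding f_ideal_def SR FC by (intro conjI allI impI)
qed

section \<open>Counting pairs and triples of indices\<close>

text \<open>The index sets of the monomials in \<open>G1\<close>, \<open>NF\<close>, \<open>G2\<close> and \<open>G3\<close>, in this order.\<close>

definition even_pairs :: "nat \<Rightarrow> nat set set" where
  "even_pairs k = {{i, j} |i j. even i \<and> even j \<and> 1 \<le> i \<and> i < j \<and> j \<le> 2 * k}"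

definition far_pairs :: "nat \<Rightarrow> nat set set" where
  "far_pairs k = {{i, j} |i j. odd i \<and> even j \<and> i + 1 < j \<and> j \<le> 2 * k}"

definition apex_triples :: "nat \<Rightarrow> nat set set" where
  "apex_triples k = insert (2 * k + 1) `
     ({P. P \<subseteq> {1..2 * k} \<and> card P = 2} - (even_pairs k \<union> far_pairs k))"

definition odd_triples :: "nat \<Rightarrow> nat set set" where
  "odd_triples k = {S. S \<subseteq> {i \<in> {1..2 * k}. odd i} \<and> card S = 3}"

lemma real_choose_two: "real (m choose 2) = real m * (real m - 1) / 2"
  by (induction m) (simp_all add: numeral_2_eq_2 field_simps)

lemma real_choose_three: "real (m choose 3) = real m * (real m - 1) * (real m - 2) / 6"
proof (induction m)
  case (Suc m)
  have "Suc m choose 3 = (m choose 2) + (m choose 3)"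
    by (simp add: numeral_3_eq_3 numeral_2_eq_2)
  then show ?case using Suc by (simp add: real_choose_two field_simps)
qed simp

lemma card_two_ordered:
  fixes P :: "'a::linorder set"
  assumes "card P = 2"
  obtains i j where "i < j" "P = {i, j}"
  using assms unfolding card_2_iff by (metis insert_commute linorder_neqE)

lemma card_three_ordered:
  fixes S :: "'a::linorder set"
  assumes "card S = 3"
  obtains i j l where "i < j" "j < l" "S = {i, j, l}"
proof -
  have S: "finite S" "S \<noteq> {}" using assms card_gt_0_iff by fastforce+
  have "card (S - {Max S}) = 2" using assms S by simp
  then obtain i j where ij: "i < j" "S - {Max S} = {i, j}" by (rule card_two_ordered)
  then have "j \<in> S" "j \<noteq> Max S" by auto
  then have "j < Max S" using S by (simp add: le_neq_trans)
  moreover have "S = {i, j, Max S}" using ij Max_in[OF S] by blast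
  ultimately show ?thesis using that ij by blast
qed

lemma card_evens: "card {i \<in> {1..2 * k}. even (i::nat)} = k"
proof -
  have "{i \<in> {1..2 * k}. even i} = (\<lambda>i. 2 * i) ` {1..k}" by (auto elim!: evenE)
  then show ?thesis by (simp add: card_image inj_on_def)
qed

lemma card_odds: "card {i \<in> {1..2 * k}. odd (i::nat)} = k"
proof -
  have "{i \<in> {1..2 * k}. odd i} = {1..2 * k} - {i \<in> {1..2 * k}. even i}" by blast
  also have "card \<dots> = card {1..2 * k} - card {i \<in> {1..2 * k}. even i}"
    by (rule card_Diff_subset) auto
  finally show ?thesis unfolding card_evens by simp
qed

lemma card_odds_with_last: "card {i \<in> {1..2 * k + 1}. odd (i::nat)} = k + 1"
proof -
  have "{i \<in> {1..2 * k + 1}. odd i} = insert (2 * k + 1) {i \<in> {1..2 * k}. odd i}"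
    by (auto simp: le_Suc_eq)
  also have "card \<dots> = Suc (card {i \<in> {1..2 * k}. odd i})"
    by (rule card_insert_disjoint) auto
  finally show ?thesis unfolding card_odds by simp
qed

lemma even_pairs_eq: "even_pairs k = {P. P \<subseteq> {i \<in> {1..2 * k}. even i} \<and> card P = 2}"
proof (intro Set.set_eqI iffI)
  fix P assume "P \<in> even_pairs k"
  then show "P \<in> {P. P \<subseteq> {i \<in> {1..2 * k}. even i} \<and> card P = 2}"
    by (auto simp: even_pairs_def)
next
  fix P assume P: "P \<in> {P. P \<subseteq> {i \<in> {1..2 * k}. even i} \<and> card P = 2}"
  then obtain i j where "i < j" "P = {i, j}" using card_two_ordered by blast
  then show "P \<in> even_pairs k" using P by (auto simp: even_pairs_def)
qed

lemma card_even_pairs: "card (even_pairs k) = k choose 2"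
  unfolding even_pairs_eq by (subst n_subsets) (simp, simp only: card_evens)

lemma inj_on_ordered_doubleton:
  "inj_on (\<lambda>(i, j). {i, j}) {(i, j). i < (j :: 'a::linorder) \<and> R i j}"
  by (rule inj_onI) (auto simp: doubleton_eq_iff)

text \<open>Shifting the smaller index by one turns a pair of \<open>NF\<close> into a pair of distinct even indices:
  the condition \<open>i + 1 < j\<close> is exactly that the two stay distinct and ordered.\<close>

lemma card_far_pairs: "card (far_pairs k) = k choose 2"
proof -
  let ?A = "{(i, j). i < j \<and> even i \<and> even j \<and> 1 \<le> i \<and> j \<le> 2 * k}"
  let ?B = "{(i, j). i < j \<and> odd i \<and> even j \<and> i + 1 < j \<and> j \<le> 2 * k}"
  let ?pair = "\<lambda>(i, j). {i, j :: nat}"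
  have A: "even_pairs k = ?pair ` ?A" unfolding even_pairs_def by auto
  have B: "far_pairs k = ?pair ` ?B" unfolding far_pairs_def by auto
  have "bij_betw (\<lambda>(i, j). (i + 1, j)) ?B ?A"
    by (rule bij_betw_byWitness[where f' = "\<lambda>(i, j). (i - 1, j)"]) (auto elim!: oddE)
  then have "card ?B = card ?A" by (rule bij_betw_same_card)
  then have "card (far_pairs k) = card (even_pairs k)"
    unfolding A B by (simp only: card_image[OF inj_on_ordered_doubleton])
  then show ?thesis by (simp only: card_even_pairs)
qed

lemma even_pairsD: "P \<in> even_pairs k \<Longrightarrow> P \<subseteq> {1..2 * k} \<and> card P = 2"
  by (auto simp: even_pairs_eq)

lemma far_pairsD: "P \<in> far_pairs k \<Longrightarrow> P \<subseteq> {1..2 * k} \<and> card P = 2"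
  by (auto simp: far_pairs_def elim!: oddE)

lemma even_element: "P \<in> even_pairs k \<union> far_pairs k \<Longrightarrow> \<exists>i\<in>P. even i"
  by (auto simp: even_pairs_def far_pairs_def)

lemma even_pairs_far_pairs_disjoint: "even_pairs k \<inter> far_pairs k = {}"
  by (auto simp: even_pairs_def far_pairs_def doubleton_eq_iff)

text \<open>The pairs \<open>{2 * a - 1, 2 * a}\<close> partition \<open>{1..2 * k}\<close> and are neither in \<open>G1\<close> nor in \<open>NF\<close>.
  They witness that every index lies in a triple of \<open>G2\<close>.\<close>

lemma consecutive_pair:
  assumes "odd i" "i \<le> 2 * k"
  shows "{i, i + 1} \<subseteq> {1..2 * k}" "{i, i + 1} \<notin> even_pairs k \<union> far_pairs k"
proof -
  have "i + 1 \<le> 2 * k" "1 \<le> i" using assms by presburger+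
  then show "{i, i + 1} \<subseteq> {1..2 * k}" by simp
  show "{i, i + 1} \<notin> even_pairs k \<union> far_pairs k"
    using assms by (auto simp: even_pairs_def far_pairs_def doubleton_eq_iff)
qed

lemma apex_triplesD:
  assumes "S \<in> apex_triples k"
  shows "S \<subseteq> {1..2 * k + 1}" "card S = 3" "2 * k + 1 \<in> S"
proof -
  obtain P where P: "P \<subseteq> {1..2 * k}" "card P = 2" "S = insert (2 * k + 1) P"
    using assms by (auto simp: apex_triples_def)
  then have "finite P" "2 * k + 1 \<notin> P" using finite_subset by auto
  then show "card S = 3" using P by simp
  show "S \<subseteq> {1..2 * k + 1}" "2 * k + 1 \<in> S" using P by auto
qed

lemma odd_triplesD: "S \<in> odd_triples k \<Longrightarrow> S \<subseteq> {1..2 * k} \<and> card S = 3"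
  by (auto simp: odd_triples_def)

text \<open>Each such pair contains an even index, which rules out triples of odd indices, and none
  contains the last index, so inside an apex triple it would have to be the base, which was chosen
  outside these pairs.\<close>

lemma triples_avoid_pairs:
  assumes S: "S \<in> apex_triples k \<union> odd_triples k" and P: "P \<in> even_pairs k \<union> far_pairs k"
  shows "\<not> P \<subseteq> S"
proof
  assume sub: "P \<subseteq> S"
  show False
  proof (cases "S \<in> odd_triples k")
    case True
    then show False using even_element[OF P] sub by (auto simp: odd_triples_def)
  next
    case False
    then obtain R where R: "R \<subseteq> {1..2 * k}" "card R = 2" "R \<notin> even_pairs k \<union> far_pairs k"
        "S = insert (2 * k + 1) R"
      using S by (auto simp: apex_triples_def)
    have "P \<subseteq> {1..2 * k}" "card P = 2" using P even_pairsD far_pairsD by blast+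
    moreover then have "P \<subseteq> R" using sub R(4) by auto
    ultimately have "P = R" using R by (metis card_subset_eq finite_atLeastAtMost finite_subset)
    then show False using P R by blast
  qed
qed

text \<open>Of the \<open>2 * k choose 2\<close> pairs, two disjoint families of size \<open>k choose 2\<close> are removed.\<close>

lemma card_apex_triples: "real (card (apex_triples k)) = (real k)\<^sup>2"
proof -
  let ?all = "{P. P \<subseteq> {1..2 * k} \<and> card P = 2}"
  let ?bad = "even_pairs k \<union> far_pairs k"
  have fin: "finite ?all" by simp
  have bad: "?bad \<subseteq> ?all" using even_pairsD far_pairsD by blast
  have finbad: "finite (even_pairs k)" "finite (far_pairs k)"
    using finite_subset[OF bad fin] by auto
  have "inj_on (insert (2 * k + 1)) (?all - ?bad)"
  proof (rule inj_onI)
    fix P R assume "P \<in> ?all - ?bad" "R \<in> ?all - ?bad"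
      and eq: "insert (2 * k + 1) P = insert (2 * k + 1) R"
    then have "2 * k + 1 \<notin> P" "2 * k + 1 \<notin> R" by auto
    then show "P = R" using eq by (metis insert_ident)
  qed
  then have "card (apex_triples k) = card (?all - ?bad)"
    unfolding apex_triples_def by (rule card_image)
  moreover have "card ?all = card (?all - ?bad) + card ?bad"
    using card_Diff_subset[OF finite_subset[OF bad fin] bad] card_mono[OF fin bad] by simp
  moreover have "card ?bad = 2 * (k choose 2)"
    using finbad by (simp add: card_Un_disjoint even_pairs_far_pairs_disjoint
        card_even_pairs card_far_pairs)
  moreover have "card ?all = 2 * k choose 2" by (subst n_subsets) simp_all
  ultimately have "card (apex_triples k) + 2 * (k choose 2) = 2 * k choose 2" by simp
  then have "real (card (apex_triples k)) + 2 * real (k choose 2) = real (2 * k choose 2)"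
    by (metis of_nat_add of_nat_mult of_nat_numeral)
  then show ?thesis by (simp add: real_choose_two field_simps power2_eq_square)
qed

lemma card_odd_triples: "card (odd_triples k) = k choose 3"
  unfolding odd_triples_def by (subst n_subsets) (simp, simp only: card_odds)

lemma even_index:
  fixes i k :: nat
  assumes "S \<subseteq> {1..2 * k + 1}" "i \<in> S" "even i"
  shows "i \<in> {i \<in> {1..2 * k}. even i}"
  using subsetD[OF assms(1,2)] assms(3) by (auto simp: le_Suc_eq)

lemma two_evens_contain_even_pair:
  assumes "S \<subseteq> {1..2 * k + 1}" "a \<in> S" "b \<in> S" "even a" "even b" "a \<noteq> b"
  shows "\<exists>P\<in>even_pairs k. P \<subseteq> S"
proof -
  have "{a, b} \<subseteq> {i \<in> {1..2 * k}. even i}"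
    using even_index[OF assms(1,2,4)] even_index[OF assms(1,3,5)] by simp
  moreover have "card {a, b} = 2" using assms(6) by simp
  ultimately have "{a, b} \<in> even_pairs k" unfolding even_pairs_eq by blast
  moreover have "{a, b} \<subseteq> S" using assms(2,3) by simp
  ultimately show ?thesis by (rule bexI[rotated])
qed

text \<open>Such a triple consists of three odd indices, or of one of the \<open>k\<close> even indices and two of the
  \<open>k + 1\<close> odd ones.\<close>

lemma card_triples_without_even_pair:
  "real (card {S. S \<subseteq> {1..2 * k + 1} \<and> card S = 3 \<and> (\<forall>P\<in>even_pairs k. \<not> P \<subseteq> S)})
     = real k * (real k + 1) * (4 * real k - 1) / 6"
proof -
  let ?O = "{i \<in> {1..2 * k + 1}. odd i}"
  let ?E = "{i \<in> {1..2 * k}. even i}"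
  let ?A = "{S. S \<subseteq> ?O \<and> card S = 3}"
  let ?P = "{P. P \<subseteq> ?O \<and> card P = 2}"
  let ?B = "(\<lambda>(e, P). insert e P) ` (?E \<times> ?P)"
  have fin: "finite S" if "S \<subseteq> ?O" for S using that by (rule finite_subset) simp
  have "{S. S \<subseteq> {1..2 * k + 1} \<and> card S = 3 \<and> (\<forall>P\<in>even_pairs k. \<not> P \<subseteq> S)} = ?A \<union> ?B"
    (is "?L = _")
  proof (intro Set.set_eqI iffI)
    fix S assume S: "S \<in> ?L"
    then have finS: "finite S" by (simp add: card_ge_0_finite)
    show "S \<in> ?A \<union> ?B"
    proof (cases "\<exists>e\<in>S. even e")
      case True
      then obtain e where e: "e \<in> S" "even e" by blast
      have "odd a" if "a \<in> S" "a \<noteq> e" for a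
        using two_evens_contain_even_pair[of S k a e] S e that by blast
      then have "S - {e} \<in> ?P" using S e finS by auto
      moreover have "e \<in> ?E" using S by (intro even_index[OF _ e]) blast
      moreover have "S = insert e (S - {e})" using e by blast
      ultimately show ?thesis by (intro UnI2 image_eqI[of _ _ "(e, S - {e})"]) simp_all
    next
      case False
      then have "S \<subseteq> ?O" using S by blast
      moreover have "card S = 3" using S by simp
      ultimately have "S \<in> ?A" by simp
      then show ?thesis by (rule UnI1)
    qed
  next
    fix S assume "S \<in> ?A \<union> ?B"
    then show "S \<in> ?L"
    proof
      assume S: "S \<in> ?A"
      then have "\<not> P \<subseteq> S" if "P \<in> even_pairs k" for P
        using even_element[of P k] that by blast
      then show ?thesis using S by blast
    next
      assume "S \<in> ?B"
      then obtain e P where eP: "e \<in> ?E" "P \<in> ?P" "S = insert e P" by auto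
      then have "e \<notin> P" "finite P" using fin by auto
      then have "card S = 3" using eP by simp
      moreover have "\<not> R \<subseteq> S" if R: "R \<in> even_pairs k" for R
      proof
        assume "R \<subseteq> S"
        moreover have "\<forall>r\<in>R. even r" "card R = 2" using R by (auto simp: even_pairs_eq)
        ultimately have "R \<subseteq> {e}" using eP by auto
        then have "card R \<le> card {e}" by (intro card_mono) simp_all
        then show False using \<open>card R = 2\<close> by simp
      qed
      moreover have "S \<subseteq> {1..2 * k + 1}" using eP by auto
      ultimately show ?thesis by blast
    qed
  qed
  moreover have "card (?A \<union> ?B) = card ?A + card ?B"
    by (rule card_Un_disjoint) auto
  moreover have "card ?A = k + 1 choose 3"
    by (subst n_subsets) (simp, simp only: card_odds_with_last)
  moreover have "card ?B = card (?E \<times> ?P)"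
  proof (rule card_image, rule inj_onI, clarify)
    fix e P e' P'
    assume *: "insert e P = insert e' P'" "P \<subseteq> ?O" "P' \<subseteq> ?O" "even e" "even e'"
    then have "e \<notin> P" "e \<notin> P'" "e' \<notin> P" by auto
    then have "e = e'" using *(1) by blast
    then show "e = e' \<and> P = P'" using * \<open>e \<notin> P\<close> \<open>e \<notin> P'\<close> by (metis insert_ident)
  qed
  moreover have "card ?P = k + 1 choose 2"
    by (subst n_subsets) (simp, simp only: card_odds_with_last)
  ultimately have "card ?L = (k + 1 choose 3) + k * (k + 1 choose 2)"
    by (simp only: card_cartesian_product card_evens)
  then have "real (card ?L) = real (k + 1 choose 3) + real k * real (k + 1 choose 2)"
    by (simp only: of_nat_add of_nat_mult)
  then show ?thesis by (simp add: real_choose_two real_choose_three field_simps)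
qed

text \<open>With at most one even index among the four, at least two odd indices below the last one
  remain, and exactly two only if the last index is present.\<close>

lemma four_indices_contain_generator:
  assumes F: "F \<subseteq> {1..2 * k + 1}" "card F = 4"
  shows "\<exists>E\<in>even_pairs k \<union> (apex_triples k \<union> odd_triples k). E \<subseteq> F"
proof (cases "\<exists>a\<in>F. \<exists>b\<in>F. even a \<and> even b \<and> a \<noteq> b")
  case True
  then show ?thesis using two_evens_contain_even_pair[OF F(1)] by blast
next
  case False
  define A where "A = {i \<in> F. odd i \<and> i \<le> 2 * k}"
  have finF: "finite F" using F by (simp add: card_ge_0_finite)
  then have finA: "finite A" by (simp add: A_def)
  \<comment> \<open>If \<open>F\<close> has no even index, \<open>e\<close> is arbitrary.\<close>
  obtain e where e: "{i \<in> F. even i} \<subseteq> {e}"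
    using False by blast
  have split: "F \<subseteq> insert e (A \<union> ({2 * k + 1} \<inter> F))"
  proof
    fix i assume i: "i \<in> F"
    then have "i \<le> 2 * k + 1" using F(1) by auto
    then show "i \<in> insert e (A \<union> ({2 * k + 1} \<inter> F))"
      using i e by (cases "even i") (auto simp: A_def le_Suc_eq)
  qed
  have "4 \<le> card (insert e (A \<union> ({2 * k + 1} \<inter> F)))"
    using card_mono[OF _ split] F(2) finA by simp
  also have "\<dots> \<le> Suc (card (A \<union> ({2 * k + 1} \<inter> F)))"
    by (rule card_insert_le_m1) (simp_all)
  also have "card (A \<union> ({2 * k + 1} \<inter> F)) \<le> card A + card ({2 * k + 1} \<inter> F)"
    by (rule card_Un_le)
  finally have bound: "3 \<le> card A + card ({2 * k + 1} \<inter> F)" by simp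
  show ?thesis
  proof (cases "3 \<le> card A")
    case True
    then obtain S where S: "S \<subseteq> A" "card S = 3" by (meson obtain_subset_with_card_n)
    then have "S \<in> odd_triples k" using F(1) unfolding odd_triples_def A_def by auto
    then show ?thesis using S unfolding A_def by blast
  next
    case False
    then have last: "2 * k + 1 \<in> F" using bound by (cases "2 * k + 1 \<in> F") auto
    then have "2 \<le> card A" using bound by simp
    then obtain P where P: "P \<subseteq> A" "card P = 2" by (meson obtain_subset_with_card_n)
    have "P \<notin> even_pairs k \<union> far_pairs k"
      using even_element[of P k] P(1) unfolding A_def by blast
    moreover have "A \<subseteq> {1..2 * k}" using F(1) by (auto simp: A_def subset_iff)
    then have "P \<subseteq> {1..2 * k}" using P(1) by blast
    ultimately have "insert (2 * k + 1) P \<in> apex_triples k"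
      using P(2) unfolding apex_triples_def by blast
    moreover have "insert (2 * k + 1) P \<subseteq> F" using P(1) last unfolding A_def by blast
    ultimately show ?thesis by blast
  qed
qed

lemma apex_triple_through:
  assumes "P \<subseteq> {1..2 * k}" "card P = 2" "P \<notin> even_pairs k \<union> far_pairs k"
  shows "insert (2 * k + 1) P \<in> apex_triples k"
  using assms unfolding apex_triples_def by blast

text \<open>The base of the covering triple is the consecutive pair that contains \<open>i\<close>, or the pair \<open>{1, 2}\<close>
  if \<open>i\<close> is the last index itself.\<close>

lemma index_with_last_covered:
  assumes "1 \<le> k" "i \<in> {1..2 * k + 1}"
  shows "\<exists>E\<in>apex_triples k. {i, 2 * k + 1} \<subseteq> E"
proof -
  obtain j where j: "odd j" "j \<le> 2 * k" "i \<in> {j, j + 1, 2 * k + 1}"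
  proof (cases "i = 2 * k + 1")
    case True
    then show ?thesis using that[of 1] assms by simp
  next
    case False
    then have "1 \<le> i" "i \<le> 2 * k" using assms by auto
    then show ?thesis using that[of i] that[of "i - 1"] by (cases "odd i") auto
  qed
  then have "insert (2 * k + 1) {j, j + 1} \<in> apex_triples k"
    using consecutive_pair[of j k] by (intro apex_triple_through) simp_all
  moreover have "{i, 2 * k + 1} \<subseteq> insert (2 * k + 1) {j, j + 1}" using j(3) by auto
  ultimately show ?thesis by (rule bexI[rotated])
qed

section \<open>The generators as sets of indices\<close>

lemma x_monom_pair: "i \<noteq> j \<Longrightarrow> x_monom {i, j} = (var i * var j :: 'a::field mpoly)"
  by (simp add: x_monom_def)

lemma x_monom_triple:
  "i \<noteq> j \<Longrightarrow> i \<noteq> l \<Longrightarrow> j \<noteq> l \<Longrightarrow> x_monom {i, j, l} = (var i * var j * var l :: 'a::field mpoly)"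
  by (simp add: x_monom_def mult.assoc)

lemma G1_eq: "(G1 k :: 'a::field mpoly set) = x_monom ` even_pairs k"
proof (intro Set.set_eqI iffI)
  fix m assume "m \<in> (G1 k :: 'a mpoly set)"
  then obtain i j where ij: "1 \<le> i" "i < j" "j \<le> k" "m = var (2 * i) * var (2 * j)"
    by (auto simp: G1_def)
  then have "{2 * i, 2 * j} \<in> even_pairs k" by (auto simp: even_pairs_eq)
  moreover have "m = x_monom {2 * i, 2 * j}" using ij by (simp add: x_monom_pair)
  ultimately show "m \<in> x_monom ` even_pairs k" by blast
next
  fix m :: "'a mpoly" assume "m \<in> x_monom ` even_pairs k"
  then obtain i j where ij: "even i" "even j" "1 \<le> i" "i < j" "j \<le> 2 * k" "m = x_monom {i, j}"
    by (auto simp: even_pairs_def)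
  then obtain a b where ab: "i = 2 * a" "j = 2 * b" by (auto elim!: evenE)
  then have "m = var (2 * a) * var (2 * b)" using ij by (simp add: x_monom_pair)
  moreover have "1 \<le> a" "a < b" "b \<le> k" using ij ab by auto
  ultimately show "m \<in> G1 k" unfolding G1_def by blast
qed

lemma NF_eq: "(NF (2 * k + 1) :: 'a::field mpoly set) = x_monom ` far_pairs k"
proof (intro Set.set_eqI iffI)
  fix m assume "m \<in> (NF (2 * k + 1) :: 'a mpoly set)"
  then obtain i j where ij: "odd i" "even j" "i + 1 < j" "j \<le> 2 * k + 1" "m = var i * var j"
    by (auto simp: NF_def)
  then have "j \<le> 2 * k" by (auto simp: le_Suc_eq)
  then have "{i, j} \<in> far_pairs k" using ij unfolding far_pairs_def by blast
  moreover have "m = x_monom {i, j}" using ij by (simp add: x_monom_pair)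
  ultimately show "m \<in> x_monom ` far_pairs k" by blast
next
  fix m :: "'a mpoly" assume "m \<in> x_monom ` far_pairs k"
  then obtain i j where ij: "odd i" "even j" "i + 1 < j" "j \<le> 2 * k" "m = x_monom {i, j}"
    by (auto simp: far_pairs_def)
  then have "m = var i * var j" by (simp add: x_monom_pair)
  moreover have "1 \<le> i" using ij(1) by (auto elim: oddE)
  moreover have "i \<le> 2 * k + 1" "1 \<le> j" "j \<le> 2 * k + 1" using ij by simp_all
  ultimately show "m \<in> NF (2 * k + 1)" using ij unfolding NF_def by blast
qed

lemma G2_eq: "(G2 k :: 'a::field mpoly set) = x_monom ` apex_triples k"
proof -
  have bad: "(var i * var j :: 'a mpoly) \<in> G1 k \<union> NF (2 * k + 1)
      \<longleftrightarrow> {i, j} \<in> even_pairs k \<union> far_pairs k" if "i < j" for i j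
  proof -
    have "\<forall>P\<in>even_pairs k \<union> far_pairs k. finite P"
      using even_pairsD far_pairsD by (metis Un_iff finite_atLeastAtMost finite_subset)
    moreover have "(var i * var j :: 'a mpoly) = x_monom {i, j}" using that by (simp add: x_monom_pair)
    ultimately show ?thesis
      unfolding G1_eq NF_eq image_Un[symmetric] by (simp only: x_monom_in_image_iff finite.intros)
  qed
  have triple: "(var i * var j * var (2 * k + 1) :: 'a mpoly) = x_monom (insert (2 * k + 1) {i, j})"
    if "i < j" "j \<le> 2 * k" for i j
    using that by (simp add: x_monom_triple[symmetric] insert_commute)
  show ?thesis
  proof (intro Set.set_eqI iffI)
    fix m assume "m \<in> (G2 k :: 'a mpoly set)"
    then obtain i j where ij: "1 \<le> i" "i < j" "j \<le> 2 * k" "m = var i * var j * var (2 * k + 1)"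
      "(var i * var j :: 'a mpoly) \<notin> G1 k \<union> NF (2 * k + 1)"
      unfolding G2_def by blast
    then have "insert (2 * k + 1) {i, j} \<in> apex_triples k"
      using bad[of i j] by (intro apex_triple_through) auto
    then show "m \<in> x_monom ` apex_triples k" using triple ij by blast
  next
    fix m :: "'a mpoly" assume "m \<in> x_monom ` apex_triples k"
    then obtain P where P: "P \<subseteq> {1..2 * k}" "card P = 2" "P \<notin> even_pairs k \<union> far_pairs k"
      "m = x_monom (insert (2 * k + 1) P)" by (auto simp: apex_triples_def)
    then obtain i j where ij: "i < j" "P = {i, j}" using card_two_ordered by blast
    then have "1 \<le> i" "j \<le> 2 * k" using P(1) by auto
    moreover have "(var i * var j :: 'a mpoly) \<notin> G1 k \<union> NF (2 * k + 1)"
      using bad P(3) ij by blast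
    moreover have "m = var i * var j * var (2 * k + 1)"
      using triple[of i j] ij P(4) \<open>j \<le> 2 * k\<close> by simp
    ultimately show "m \<in> G2 k" using ij unfolding G2_def by blast
  qed
qed

lemma G3_eq: "(G3 k :: 'a::field mpoly set) = x_monom ` odd_triples k"
proof (intro Set.set_eqI iffI)
  fix m assume "m \<in> (G3 k :: 'a mpoly set)"
  then obtain i j l where ijl: "1 \<le> i" "i < j" "j < l" "l \<le> 2 * k" "odd i" "odd j" "odd l"
    "m = var i * var j * var l" unfolding G3_def by blast
  then have "{i, j, l} \<in> odd_triples k" by (auto simp: odd_triples_def)
  moreover have "m = x_monom {i, j, l}" using ijl by (simp add: x_monom_triple)
  ultimately show "m \<in> x_monom ` odd_triples k" by blast
next
  fix m :: "'a mpoly" assume "m \<in> x_monom ` odd_triples k"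
  then obtain S where S: "S \<subseteq> {i \<in> {1..2 * k}. odd i}" "card S = 3" "m = x_monom S"
    by (auto simp: odd_triples_def)
  obtain i j l where ijl: "i < j" "j < l" "S = {i, j, l}" using S(2) by (rule card_three_ordered)
  then have "m = var i * var j * var l" using S(3) by (simp add: x_monom_triple)
  moreover have "1 \<le> i" "l \<le> 2 * k" "odd i" "odd j" "odd l" using S(1) ijl by auto
  ultimately show "m \<in> G3 k" using ijl unfolding G3_def by blast
qed

theorem theorem4p2:
  fixes k n :: nat and G4 :: "'a::field mpoly set"
  assumes "n = 2 * k + 1" and "k \<ge> 3" and "k mod 4 = 0 \<or> k mod 4 = 3"
    and "G4 \<subseteq> sqfree_monomials_deg n 3"
    and "real (card G4) =
           1 / 2 * (real k * (real k + 1) * (4 * real k - 1) / 6)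
           - (real k * (real k - 1) * (real k - 2) + 6 * (real k)\<^sup>2) / 6"
    and "\<forall>m \<in> G4. m \<notin> G2 k \<union> G3 k"
    and "\<forall>m \<in> G4. \<forall>d \<in> G1 k \<union> NF n. \<not> d dvd m"
  shows "f_ideal n (Idl\<^bsub>poly_ring n\<^esub> (G1 k \<union> G2 k \<union> G3 k \<union> G4))"
proof -
  define X where "X = {F. F \<subseteq> {1..n} \<and> card F = 3 \<and> (x_monom F :: 'a mpoly) \<in> G4}"
  let ?Q = "even_pairs k"
  let ?AO = "apex_triples k \<union> odd_triples k"
  let ?T = "?AO \<union> X"
  have fin: "finite F" if "F \<subseteq> {1..n}" for F using that finite_subset by blast
  have finfam: "finite \<F>" if "\<And>E. E \<in> \<F> \<Longrightarrow> E \<subseteq> {1..n}" for \<F>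
    by (rule finite_subset[of _ "Pow {1..n}"]) (use that in auto)
  have G4_eq: "G4 = x_monom ` X"
    using assms(4) unfolding X_def sqfree_monomials_deg_def by auto
  have pairD: "P \<subseteq> {1..n} \<and> card P = 2" if "P \<in> ?Q \<union> far_pairs k" for P
  proof -
    have "P \<subseteq> {1..2 * k}" "card P = 2" using that even_pairsD far_pairsD by blast+
    moreover have "{1..2 * k} \<subseteq> {1..n}" using assms(1) by auto
    ultimately show ?thesis by blast
  qed
  have AO: "E \<subseteq> {1..n} \<and> card E = 3" if "E \<in> ?AO" for E
  proof -
    have "{1..2 * k} \<subseteq> {1..n}" using assms(1) by auto
    then show ?thesis
      using that apex_triplesD(1,2)[of E k] odd_triplesD[of E k] unfolding assms(1) by blast
  qed
  then have T: "E \<subseteq> {1..n} \<and> card E = 3" if "E \<in> ?T" for E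
    using that unfolding X_def by blast
  have avoid: "\<not> P \<subseteq> E" if P: "P \<in> ?Q \<union> far_pairs k" and E: "E \<in> ?T" for P E
  proof (cases "E \<in> X")
    case True
    have "(x_monom P :: 'a mpoly) \<in> G1 k \<union> NF n" 
      using P by (auto simp: G1_eq NF_eq assms(1) simp del: One_nat_def)
    then have "\<not> (x_monom P :: 'a mpoly) dvd x_monom E"
      using True assms(7) unfolding X_def by blast
    then show ?thesis using x_monom_dvd_iff[of P E, where 'a = 'a] fin pairD[OF P] T[OF E] by blast
  next
    case False
    then show ?thesis using triples_avoid_pairs P E by blast
  qed
  have X_disj: "?AO \<inter> X = {}"
    using assms(6) unfolding G2_eq G3_eq X_def by blast
  have uncovered:
    "{P. P \<subseteq> {1..n} \<and> card P = 2 \<and> (\<forall>E\<in>?Q \<union> ?T. \<not> P \<subseteq> E)} = far_pairs k"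
  proof (intro Set.set_eqI iffI)
    fix P assume P: "P \<in> {P. P \<subseteq> {1..n} \<and> card P = 2 \<and> (\<forall>E\<in>?Q \<union> ?T. \<not> P \<subseteq> E)}"
    show "P \<in> far_pairs k"
    proof (cases "n \<in> P")
      case True
      then obtain i where "P = {i, n}" using P by (auto simp: card_2_iff)
      then have "\<exists>E\<in>apex_triples k. P \<subseteq> E"
        using index_with_last_covered[of k i] P assms(1,2) by auto
      then show ?thesis using P by blast
    next
      case False
      then have "P \<subseteq> {1..2 * k}" using P assms(1) by (auto simp: subset_iff le_Suc_eq)
      then show ?thesis using apex_triple_through[of P k] P by blast
    qed
  next
    fix P assume P: "P \<in> far_pairs k"
    then have "\<not> P \<subseteq> E" if "E \<in> ?Q \<union> ?T" for E
    proof (cases "E \<in> ?Q")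
      case True
      then have "P \<noteq> E" using P even_pairs_far_pairs_disjoint by blast
      then show ?thesis using pairD[of P] pairD[of E] P True fin by (metis UnCI card_subset_eq)
    next
      case False
      then show ?thesis using avoid P that by blast
    qed
    then show "P \<in> {P. P \<subseteq> {1..n} \<and> card P = 2 \<and> (\<forall>E\<in>?Q \<union> ?T. \<not> P \<subseteq> E)}"
      using pairD P by blast
  qed
  have "card ?T = card (apex_triples k) + card (odd_triples k) + card X"
  proof -
    have "apex_triples k \<inter> odd_triples k = {}"
      using apex_triplesD(3) odd_triplesD by fastforce
    then have "card ?AO = card (apex_triples k) + card (odd_triples k)"
      using AO by (intro card_Un_disjoint finfam) blast+
    moreover have "card ?T = card ?AO + card X"
      using T X_disj by (intro card_Un_disjoint finfam) blast+
    ultimately show ?thesis by simp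
  qed
  moreover have "card G4 = card X"
    unfolding G4_eq by (rule card_image) (auto simp: inj_on_def X_def x_monom_inject fin)
  \<comment> \<open>The prescribed size of \<open>G4\<close> enters here and completes \<open>T\<close> to half of the admissible triples.\<close>
  ultimately have "2 * real (card ?T) = real k * (real k + 1) * (4 * real k - 1) / 6"
    using assms(5)
    by (simp add: card_apex_triples card_odd_triples real_choose_three field_simps power2_eq_square)
  then have "real (2 * card ?T) = real (card {S. S \<subseteq> {1..n} \<and> card S = 3 \<and> (\<forall>E\<in>?Q. \<not> E \<subseteq> S)})"
    unfolding assms(1) card_triples_without_even_pair by simp
  then have triples: "card {S. S \<subseteq> {1..n} \<and> card S = 3 \<and> (\<forall>E\<in>?Q. \<not> E \<subseteq> S)} = 2 * card ?T"
    by (simp only: of_nat_eq_iff)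
  have "f_ideal n (Idl\<^bsub>poly_ring n\<^esub> (x_monom ` (?Q \<union> ?T) :: 'a mpoly set))"
  proof (rule f_ideal_of_pairs_and_triples)
    show "0 < n" using assms(1) by simp
    show "\<And>E. E \<in> ?Q \<Longrightarrow> E \<subseteq> {1..n} \<and> card E = 2" using pairD by blast
    show "\<And>E. E \<in> ?T \<Longrightarrow> E \<subseteq> {1..n} \<and> card E = 3" by (rule T)
    show "\<And>P E. P \<in> ?Q \<Longrightarrow> E \<in> ?T \<Longrightarrow> \<not> P \<subseteq> E" using avoid by blast
    show "\<exists>E\<in>?Q \<union> ?T. i \<in> E" if "i \<in> {1..n}" for i
      using index_with_last_covered[of k i] that assms(1,2) by auto
    show "card {P. P \<subseteq> {1..n} \<and> card P = 2 \<and> (\<forall>E\<in>?Q \<union> ?T. \<not> P \<subseteq> E)} = card ?Q"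
      unfolding uncovered by (simp add: card_far_pairs card_even_pairs)
    show "\<exists>E\<in>?Q \<union> ?T. E \<subseteq> F" if "F \<subseteq> {1..n}" "card F = 4" for F
      using four_indices_contain_generator[of F k] that assms(1) by blast
  qed (rule triples)
  moreover have "G1 k \<union> G2 k \<union> G3 k \<union> G4 = (x_monom ` (?Q \<union> ?T) :: 'a mpoly set)"
    unfolding G1_eq G2_eq G3_eq G4_eq image_Un by (simp only: Un_assoc)
  ultimately show ?thesis by simp
qed

end
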